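(* Let $A\in\mathbb{R}^{n\times n}$, $B=[B_1\ \cdots\ B_m]\in\mathbb{R}^{n\times m}$ (columns $B_i$), $E=[E_1^{\top}\ \cdots\ E_m^{\top}]^{\top}\in\mathbb{R}^{m\times n}_+$ (rows $E_i\ne 0$), $s\in\mathbb{R}^n$ and $r\in\mathbb{R}^m$ be such that $A-|B|E$ is Metzler and $s\ge E^{\top}|r|$. Suppose that the equation $$0= s + A^{\top}p -E^{\top}\left| r+B^{\top}p \right|$$ has a finite solution $p\in\mathbb{R}^n_+$. Let $K$ satisfy $$K\in\begin{bmatrix}\operatorname{sign}(r_1+p^{\top}B_1)E_1\\ \vdots\\ \operatorname{sign}(r_m+p^{\top}B_m)E_m\end{bmatrix}.$$ If the pair $(s^{\top}-r^{\top}K,\ A-BK)$ is detectable, then $u(t)=-Kx(t)$ stabilizes the system $\dot x=Ax+Bu$, i.e. $A-BK$ is Hurwitz.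
   Context: Inequalities between vectors or matrices are elementwise, $|X|$ denotes the elementwise absolute value, and $\mathbb{R}^n_+$, $\mathbb{R}^{m\times n}_+$ denote vectors/matrices with nonnegative entries. A square matrix is Metzler if its off-diagonal entries are nonnegative, and Hurwitz if all its eigenvalues have strictly negative real part. The signum is set-valued: $\operatorname{sign}(y)=\{+1\}$ if $y>0$, $\{-1\}$ if $y<0$, and $[-1,1]$ if $y=0$; the inclusion for $K$ means that the $i$-th row of $K$ is $\sigma E_i$ for some $\sigma\in\operatorname{sign}(r_i+p^{\top}B_i)$. A pair $(C,M)$ (system $\dot x=Mx$, $y=Cx$) is detectable if all unobservable states are (asymptotically) stable. *)

theory Defs
  imports "HOL-Analysis.Analysis"
begin

text \<open>The library's order and absolute value on \<open>real ^ 'n\<close> and \<open>real ^ 'n ^ 'm\<close> are elementwise.\<close>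

definition metzler :: "real ^ 'n ^ 'n \<Rightarrow> bool" where
  "metzler M \<longleftrightarrow> (\<forall>i j. i \<noteq> j \<longrightarrow> 0 \<le> M $ i $ j)"

definition eigenvalue :: "real ^ 'n ^ 'n \<Rightarrow> complex \<Rightarrow> bool" where
  "eigenvalue M \<mu> \<longleftrightarrow>
     (\<exists>v :: complex ^ 'n. v \<noteq> 0 \<and> (\<chi> i j. complex_of_real (M $ i $ j)) *v v = \<mu> *s v)"

definition hurwitz :: "real ^ 'n ^ 'n \<Rightarrow> bool" where
  "hurwitz M \<longleftrightarrow> (\<forall>\<mu>. eigenvalue M \<mu> \<longrightarrow> Re \<mu> < 0)"

definition sign_set :: "real \<Rightarrow> real set" where
  "sign_set y = (if y > 0 then {1} else if y < 0 then {-1} else {-1..1})"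

definition trajectory :: "real ^ 'n ^ 'n \<Rightarrow> real ^ 'n \<Rightarrow> (real \<Rightarrow> real ^ 'n) \<Rightarrow> bool" where
  "trajectory M x0 x \<longleftrightarrow>
     x 0 = x0 \<and> (\<forall>t\<ge>0. (x has_vector_derivative M *v x t) (at t within {0..}))"

text \<open>Trajectories exist and are unique on \<open>{0..}\<close>, so the choice of quantifier over \<open>x\<close> in the next two
  definitions is immaterial.\<close>

definition unobservable_state ::
    "real ^ 'n ^ 'p \<Rightarrow> real ^ 'n ^ 'n \<Rightarrow> real ^ 'n \<Rightarrow> bool" where
  "unobservable_state C M x0 \<longleftrightarrow> (\<exists>x. trajectory M x0 x \<and> (\<forall>t\<ge>0. C *v x t = 0))"

definition asymp_stable_state :: "real ^ 'n ^ 'n \<Rightarrow> real ^ 'n \<Rightarrow> bool" where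
  "asymp_stable_state M x0 \<longleftrightarrow> (\<forall>x. trajectory M x0 x \<longrightarrow> (x \<longlongrightarrow> 0) at_top)"

definition detectable :: "real ^ 'n ^ 'p \<Rightarrow> real ^ 'n ^ 'n \<Rightarrow> bool" where
  "detectable C M \<longleftrightarrow> (\<forall>x0. unobservable_state C M x0 \<longrightarrow> asymp_stable_state M x0)"

end

theory Submission
  imports Defs
begin

text \<open>With \<open>M = A - B K\<close> and \<open>c = s - K\<^sup>T r\<close>, the choice of signs turns the equation for \<open>p\<close> into
  \<open>c + M\<^sup>T p = 0\<close>, where \<open>c \<ge> 0\<close> and \<open>M\<close> is Metzler. If \<open>M\<close> is not Hurwitz, a Perron-Frobenius
  argument yields \<open>\<lambda> \<ge> 0\<close> and \<open>x \<ge> 0\<close>, \<open>x \<noteq> 0\<close>, with \<open>M x = \<lambda> x\<close>. Then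
  \<open>\<lambda> (p \<bullet> x) = p \<bullet> M x = - (c \<bullet> x)\<close> forces \<open>c \<bullet> x = 0\<close>, so that \<open>exp (\<lambda> t) x\<close> is an unobservable
  trajectory that does not converge to \<open>0\<close>, contradicting detectability.\<close>

text \<open>The witness is the entrywise modulus of a complex eigenvector. In each row the diagonal
  term is moved to the side of \<open>\<mu>\<close>; the remaining coefficients are nonnegative, so
  the triangle inequality bounds them by their action on the moduli, and the real part of
  \<open>\<mu> - M $ i $ i\<close> is at most its modulus.\<close>

lemma metzler_eigenvalue_abs_subinvariant:
  fixes M :: "real ^ 'n ^ 'n"
  assumes M: "metzler M" and ev: "eigenvalue M \<mu>"
  obtains v where "0 \<le> v" "v \<noteq> 0" "Re \<mu> *\<^sub>R v \<le> M *v v"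
proof -
  from ev obtain w :: "complex ^ 'n" where w0: "w \<noteq> 0"
    and w: "(\<chi> i j. complex_of_real (M $ i $ j)) *v w = \<mu> *s w"
    unfolding eigenvalue_def by blast
  define v :: "real ^ 'n" where "v = (\<chi> i. cmod (w $ i))"
  have "Re \<mu> * v $ i \<le> (M *v v) $ i" for i
  proof -
    have "(\<Sum>j\<in>UNIV. complex_of_real (M $ i $ j) * w $ j) = \<mu> * w $ i"
      using arg_cong[OF w, of "\<lambda>x. x $ i"] by (simp add: matrix_vector_mult_def)
    hence "(\<Sum>j\<in>UNIV - {i}. complex_of_real (M $ i $ j) * w $ j)
        = (\<mu> - complex_of_real (M $ i $ i)) * w $ i"
      by (simp add: sum.remove[of UNIV i] algebra_simps)
    hence "cmod (\<mu> - complex_of_real (M $ i $ i)) * cmod (w $ i)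
        = cmod (\<Sum>j\<in>UNIV - {i}. complex_of_real (M $ i $ j) * w $ j)"
      by (simp add: norm_mult)
    also have "\<dots> \<le> (\<Sum>j\<in>UNIV - {i}. cmod (complex_of_real (M $ i $ j) * w $ j))"
      by (rule norm_sum)
    also have "\<dots> = (\<Sum>j\<in>UNIV - {i}. M $ i $ j * v $ j)"
      using M by (intro sum.cong) (auto simp: metzler_def norm_mult v_def)
    finally have "cmod (\<mu> - complex_of_real (M $ i $ i)) * cmod (w $ i)
        \<le> (\<Sum>j\<in>UNIV - {i}. M $ i $ j * v $ j)" .
    moreover have "(Re \<mu> - M $ i $ i) * cmod (w $ i)
        \<le> cmod (\<mu> - complex_of_real (M $ i $ i)) * cmod (w $ i)"
      using complex_Re_le_cmod[of "\<mu> - complex_of_real (M $ i $ i)"]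
      by (intro mult_right_mono) auto
    ultimately show ?thesis
      by (simp add: matrix_vector_mult_def sum.remove[of UNIV i] v_def algebra_simps)
  qed
  moreover have "0 \<le> v" by (simp add: v_def less_eq_vec_def)
  moreover have "v \<noteq> 0" using w0 by (auto simp: v_def vec_eq_iff)
  ultimately show ?thesis by (intro that[of v]) (auto simp: less_eq_vec_def)
qed

lemma matrix_vector_mult_nonneg_mono:
  fixes N :: "real ^ 'n ^ 'm"
  assumes "0 \<le> N" "x \<le> y"
  shows "N *v x \<le> N *v y"
  using assms by (auto simp: less_eq_vec_def matrix_vector_mult_def intro!: sum_mono mult_left_mono)

text \<open>Brouwer's theorem is applied on the part of the standard simplex where \<open>\<beta> x \<le> N x\<close>, which
  the normalised action of \<open>N\<close> preserves; no irreducibility is needed.\<close>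

lemma nonneg_matrix_subinvariant_eigenvector:
  fixes N :: "real ^ 'n ^ 'n"
  assumes N: "0 \<le> N" and \<beta>: "0 < \<beta>" and v: "0 \<le> v" "v \<noteq> 0" "\<beta> *\<^sub>R v \<le> N *v v"
  obtains \<rho> x where "\<beta> \<le> \<rho>" "0 \<le> x" "x \<noteq> 0" "N *v x = \<rho> *\<^sub>R x"
proof -
  \<comment> \<open>On nonnegative vectors \<open>h\<close> is the 1-norm, but it is linear
    everywhere, which makes \<open>S\<close> convex.\<close>
  define h :: "real ^ 'n \<Rightarrow> real" where "h x = (\<Sum>i\<in>UNIV. x $ i)" for x
  define S where "S = {x. 0 \<le> x \<and> h x = 1 \<and> \<beta> *\<^sub>R x \<le> N *v x}"
  define f where "f x = (1 / h (N *v x)) *\<^sub>R (N *v x)" for x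
  have h_scale: "h (a *\<^sub>R x) = a * h x" for a x
    by (simp add: h_def sum_distrib_left)
  have h_add: "h (x + y) = h x + h y" for x y
    by (simp add: h_def sum.distrib)
  have h_mono: "h x \<le> h y" if "x \<le> y" for x y
    using that by (auto simp: h_def less_eq_vec_def intro: sum_mono)
  have h_cont: "continuous_on T h" for T
    unfolding h_def by (intro continuous_intros)
  have N_cont: "continuous_on T ((*v) N)" for T
    by (intro linear_continuous_on matrix_vector_mul_bounded_linear)
  have h_pos: "0 < h x" if "0 \<le> x" "x \<noteq> 0" for x
  proof -
    have "\<exists>i. x $ i \<noteq> 0" using that(2) by (simp add: vec_eq_iff)
    then obtain i where "x $ i \<noteq> 0" ..
    with that show ?thesis
      unfolding h_def by (intro sum_pos2[of _ i]) (auto simp: less_eq_vec_def order_less_le)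
  qed
  \<comment> \<open>The constraint \<open>\<beta> *\<^sub>R x \<le> N *v x\<close> in
    \<open>S\<close> serves twice: the normalisation in \<open>f\<close> never divides by zero, even
    if \<open>N\<close> is singular, and the eigenvalue \<open>h (N *v x)\<close> at a fixed point
    is at least \<open>\<beta>\<close>.\<close>
  have hN: "\<beta> \<le> h (N *v x)" if "x \<in> S" for x
    using that h_mono[of "\<beta> *\<^sub>R x" "N *v x"] by (auto simp: S_def h_scale)
  have normalise: "(1 / h y) *\<^sub>R y \<in> S" if "0 < h y" "0 \<le> y" "\<beta> *\<^sub>R y \<le> N *v y" for y
  proof -
    have "\<beta> *\<^sub>R (1 / h y) *\<^sub>R y \<le> N *v ((1 / h y) *\<^sub>R y)"
      using that scaleR_left_mono[OF that(3), of "1 / h y"]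
      by (simp add: matrix_vector_mult_scaleR mult.commute)
    with that show ?thesis
      by (auto simp: S_def h_scale less_eq_vec_def)
  qed
  have "f x \<in> S" if "x \<in> S" for x
    unfolding f_def
  proof (rule normalise)
    have x: "0 \<le> x" "\<beta> *\<^sub>R x \<le> N *v x" using that by (auto simp: S_def)
    show "0 < h (N *v x)" using hN[OF that] \<beta> by linarith
    show "0 \<le> N *v x" using matrix_vector_mult_nonneg_mono[OF N x(1)] by simp
    show "\<beta> *\<^sub>R (N *v x) \<le> N *v (N *v x)"
      using matrix_vector_mult_nonneg_mono[OF N x(2)] by (simp add: matrix_vector_mult_scaleR)
  qed
  hence "f \<in> S \<rightarrow> S" by blast
  moreover have "continuous_on S f"
    unfolding f_def using hN \<beta>
    by (intro continuous_intros N_cont continuous_on_compose2[OF h_cont N_cont]) force+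
  moreover have "convex S"
  proof (rule convexI)
    fix x y and a b :: real
    assume xy: "x \<in> S" "y \<in> S" and ab: "0 \<le> a" "0 \<le> b" "a + b = 1"
    have "a *\<^sub>R (\<beta> *\<^sub>R x) + b *\<^sub>R (\<beta> *\<^sub>R y) \<le> a *\<^sub>R (N *v x) + b *\<^sub>R (N *v y)"
      using xy ab by (intro add_mono scaleR_left_mono) (auto simp: S_def)
    moreover have "0 \<le> a *\<^sub>R x + b *\<^sub>R y"
      using xy ab by (simp add: S_def less_eq_vec_def)
    ultimately show "a *\<^sub>R x + b *\<^sub>R y \<in> S"
      using xy ab
      by (simp add: S_def h_add h_scale matrix_vector_right_distrib matrix_vector_mult_scaleR
          scaleR_add_right mult.commute)
  qed
  moreover have "compact S"
  proof -
    have "S \<subseteq> {0..1}"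
    proof
      fix x assume x: "x \<in> S"
      have "x $ i \<le> h x" for i
        using x unfolding h_def by (intro member_le_sum) (auto simp: S_def less_eq_vec_def)
      with x show "x \<in> {0..1}" by (auto simp: S_def less_eq_vec_def)
    qed
    moreover have "closed S"
      unfolding S_def less_eq_vec_def
      by (intro closed_Collect_conj closed_Collect_all closed_Collect_le closed_Collect_eq
          continuous_intros h_cont N_cont)
    ultimately show ?thesis
      by (metis bounded_cbox bounded_subset compact_eq_bounded_closed interval_cbox)
  qed
  moreover have "S \<noteq> {}" using normalise[of v] h_pos[of v] v by blast
  ultimately obtain x where x: "x \<in> S" "f x = x" using brouwer[of S f] by blast
  have "h (N *v x) \<noteq> 0" using hN[OF x(1)] \<beta> by linarith
  hence "N *v x = h (N *v x) *\<^sub>R f x" by (simp add: f_def)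
  moreover have "0 \<le> x" "x \<noteq> 0" using x by (auto simp: S_def h_def)
  ultimately show ?thesis using that[OF hN[OF x(1)]] x(2) by metis
qed

text \<open>Adding a multiple of the identity keeps the eigenvectors and shifts the eigenvalues,
  which reduces the claim to a nonnegative matrix.\<close>

lemma metzler_nonneg_eigenvector:
  fixes M :: "real ^ 'n ^ 'n"
  assumes M: "metzler M" and ev: "eigenvalue M \<mu>"
  obtains l x where "Re \<mu> \<le> l" "0 \<le> x" "x \<noteq> 0" "M *v x = l *\<^sub>R x"
proof -
  obtain v where v: "0 \<le> v" "v \<noteq> 0" "Re \<mu> *\<^sub>R v \<le> M *v v"
    using metzler_eigenvalue_abs_subinvariant[OF M ev] .
  \<comment> \<open>The sum dominates every \<open>- M $ i $ i\<close>, so the shifted diagonal is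
    nonnegative; the first two terms give \<open>1 \<le> Re \<mu> + k\<close>.\<close>
  define k where "k = \<bar>Re \<mu>\<bar> + 1 + (\<Sum>i\<in>UNIV. \<bar>M $ i $ i\<bar>)"
  define N where "N = M + k *\<^sub>R mat 1"
  have Nv: "N *v x = M *v x + k *\<^sub>R x" for x
    by (simp add: N_def matrix_vector_mult_add_rdistrib scaleR_matrix_vector_assoc[symmetric])
  have "0 \<le> \<bar>Re \<mu>\<bar> + 1 + (\<Sum>i\<in>UNIV. \<bar>M $ i $ i\<bar>) + M $ i $ i" for i
    using member_le_sum[of i UNIV "\<lambda>i. \<bar>M $ i $ i\<bar>"] by simp
  hence "0 \<le> N"
    using M by (auto simp: N_def less_eq_vec_def mat_def metzler_def k_def algebra_simps)
  moreover have "0 < Re \<mu> + k"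
    using sum_abs_ge_zero[of "\<lambda>i. M $ i $ i" UNIV] unfolding k_def by linarith
  moreover have "(Re \<mu> + k) *\<^sub>R v \<le> N *v v"
    using v(3) by (simp add: Nv scaleR_add_left)
  ultimately obtain \<rho> x where "Re \<mu> + k \<le> \<rho>" "0 \<le> x" "x \<noteq> 0" "N *v x = \<rho> *\<^sub>R x"
    using nonneg_matrix_subinvariant_eigenvector v(1,2) by metis
  thus ?thesis
    by (intro that[of "\<rho> - k" x]) (auto simp: Nv algebra_simps)
qed

lemma trajectory_exp_eigenvector:
  assumes "M *v x = l *\<^sub>R x"
  shows "trajectory M x (\<lambda>t. exp (l * t) *\<^sub>R x)"
proof -
  have "((\<lambda>t. exp (l * t)) has_real_derivative exp (l * t) * l) (at t within T)" for t T
    by (auto intro!: derivative_eq_intros)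
  hence "((\<lambda>t. exp (l * t) *\<^sub>R x) has_vector_derivative M *v (exp (l * t) *\<^sub>R x)) (at t within T)"
    for t T
    using has_vector_derivative_scaleR[OF _ has_vector_derivative_const]
    by (fastforce simp: assms matrix_vector_mult_scaleR)
  thus ?thesis by (simp add: trajectory_def)
qed

text \<open>The trajectory \<open>exp (l * t) *\<^sub>R x\<close> has zero output, and for
  \<open>l \<ge> 0\<close> its norm never drops below \<open>norm x\<close>.\<close>

lemma detectable_eigenvector:
  assumes det: "detectable C M" and x: "M *v x = l *\<^sub>R x" "C *v x = 0" "x \<noteq> 0"
  shows "l < 0"
proof (rule ccontr)
  assume "\<not> l < 0"
  let ?x = "\<lambda>t. exp (l * t) *\<^sub>R x"
  have "unobservable_state C M x"
    using trajectory_exp_eigenvector[OF x(1)] x(2)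
    by (auto simp: unobservable_state_def matrix_vector_mult_scaleR intro!: exI[of _ ?x])
  hence "(?x \<longlongrightarrow> 0) at_top"
    using det trajectory_exp_eigenvector[OF x(1)] by (auto simp: detectable_def asymp_stable_state_def)
  hence "((\<lambda>t. norm (?x t)) \<longlongrightarrow> 0) at_top"
    by (rule tendsto_norm_zero)
  moreover have "\<forall>\<^sub>F t in at_top. norm x \<le> norm (?x t)"
    using eventually_ge_at_top[of 0]
  proof eventually_elim
    case (elim t)
    have "1 \<le> exp (l * t)" using elim \<open>\<not> l < 0\<close> by simp
    thus ?case using mult_right_mono[of 1 "exp (l * t)" "norm x"] by simp
  qed
  ultimately have "norm x \<le> 0"
    by (intro tendsto_lowerbound) auto
  with x(3) show False by simp
qed

theorem theorem6:
  fixes A :: "real ^ 'n ^ 'n"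
    and B :: "real ^ 'm ^ 'n"
    and E :: "real ^ 'n ^ 'm"
    and K :: "real ^ 'n ^ 'm"
    and s p :: "real ^ 'n"
    and r :: "real ^ 'm"
  assumes "0 \<le> E"
    and "\<And>i. row i E \<noteq> 0"
    and "metzler (A - \<bar>B\<bar> ** E)"
    and "transpose E *v \<bar>r\<bar> \<le> s"
    and "0 \<le> p"
    and "0 = s + transpose A *v p - transpose E *v \<bar>r + transpose B *v p\<bar>"
    and "\<And>i. \<exists>\<sigma>\<in>sign_set (r $ i + p \<bullet> column i B). row i K = \<sigma> *\<^sub>R row i E"
    and "detectable (rowvector (s - r v* K) :: real ^ 'n ^ 1) (A - B ** K)"
  shows "hurwitz (A - B ** K)"
proof -
  let ?M = "A - B ** K"
  define c where "c = s - r v* K"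
  define y where "y = r + transpose B *v p"
  have y: "y $ i = r $ i + p \<bullet> column i B" for i
    by (simp add: y_def matrix_vector_mult_def transpose_def inner_vec_def column_def mult.commute)
  have E0: "0 \<le> E $ i $ j" for i j
    using assms(1) by (simp add: less_eq_vec_def)
  have KE: "\<exists>\<sigma>\<in>sign_set (y $ i). \<forall>j. K $ i $ j = \<sigma> * E $ i $ j" for i
    using assms(7)[of i] unfolding y by (auto simp: row_def vec_eq_iff)
  \<comment> \<open>Every admissible sign has modulus at most 1, also at a zero of \<open>y\<close>.
    This one bound gives both the Metzler property of \<open>?M\<close> and
    \<open>0 \<le> c\<close>.\<close>
  have K_le: "\<bar>K $ i $ j\<bar> \<le> E $ i $ j" for i j
  proof -
    obtain \<sigma> where "\<sigma> \<in> sign_set (y $ i)" "K $ i $ j = \<sigma> * E $ i $ j" using KE by blast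
    moreover from this have "\<bar>\<sigma>\<bar> \<le> 1" by (auto simp: sign_set_def split: if_splits)
    ultimately show ?thesis
      using mult_right_mono[of "\<bar>\<sigma>\<bar>" 1 "E $ i $ j"] E0[of i j] by (simp add: abs_mult)
  qed
  \<comment> \<open>Where \<open>y $ i = 0\<close>, both sides vanish whatever element of
    \<open>[-1,1]\<close> was chosen.\<close>
  have yK: "y $ i * K $ i $ j = \<bar>y $ i\<bar> * E $ i $ j" for i j
    using KE[of i] by (auto simp: sign_set_def split: if_splits)

  have M: "metzler ?M"
    unfolding metzler_def
  proof (intro allI impI)
    \<comment> \<open>Off the diagonal, \<open>?M\<close> dominates
      \<open>A - \<bar>B\<bar> ** E\<close>.\<close>
    fix i j :: 'n assume "i \<noteq> j"
    have "B $ i $ k * K $ k $ j \<le> \<bar>B $ i $ k\<bar> * E $ k $ j" for k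
      using abs_ge_self[of "B $ i $ k * K $ k $ j"]
        mult_left_mono[OF K_le[of k j], of "\<bar>B $ i $ k\<bar>"] by (simp add: abs_mult)
    hence "(B ** K) $ i $ j \<le> (\<bar>B\<bar> ** E) $ i $ j"
      by (simp add: matrix_matrix_mult_def abs_vec_def sum_mono)
    thus "0 \<le> ?M $ i $ j"
      using assms(3) \<open>i \<noteq> j\<close> by (auto simp: metzler_def intro: order_trans)
  qed

  have c0: "0 \<le> c"
    unfolding less_eq_vec_def
  proof
    fix j
    have "r $ i * K $ i $ j \<le> E $ i $ j * \<bar>r $ i\<bar>" for i
      using abs_ge_self[of "r $ i * K $ i $ j"]
        mult_left_mono[OF K_le[of i j], of "\<bar>r $ i\<bar>"] by (simp add: abs_mult mult.commute)
    hence "(r v* K) $ j \<le> (transpose E *v \<bar>r\<bar>) $ j"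
      by (simp add: vector_matrix_mult_def matrix_vector_mult_def transpose_def abs_vec_def sum_mono
          mult.commute)
    also have "\<dots> \<le> s $ j" using assms(4) by (simp add: less_eq_vec_def)
    finally show "0 $ j \<le> c $ j" by (simp add: c_def)
  qed

  \<comment> \<open>The selected signs remove the absolute value; expanding \<open>y\<close> then
    splits \<open>y v* K\<close> into \<open>r v* K\<close>, absorbed in \<open>c\<close>, and
    \<open>p v* (B ** K)\<close>, absorbed in \<open>?M\<close>.\<close>
  have "y v* K = transpose E *v \<bar>y\<bar>"
    using yK by (simp add: vec_eq_iff vector_matrix_mult_def matrix_vector_mult_def transpose_def
        abs_vec_def mult.commute)
  hence "c + p v* ?M = 0"
    using assms(6)
    by (simp add: c_def y_def vector_matrix_left_distrib vector_matrix_mul_assoc algebra_simps)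
  hence balance: "c \<bullet> x + p \<bullet> (?M *v x) = 0" for x
    by (metis dot_lmul_matrix inner_add_left inner_zero_left)

  show ?thesis
    unfolding hurwitz_def
  proof (intro allI impI)
    fix \<mu> assume "eigenvalue ?M \<mu>"
    then obtain l x where l: "Re \<mu> \<le> l" and x: "0 \<le> x" "x \<noteq> 0" "?M *v x = l *\<^sub>R x"
      using metzler_nonneg_eigenvector[OF M] by metis
    have nonneg: "0 \<le> a \<bullet> x" if "0 \<le> a" for a
      using that x(1) by (simp add: inner_vec_def less_eq_vec_def sum_nonneg)
    have "l < 0"
    proof (rule ccontr)
      assume "\<not> l < 0"
      hence "0 \<le> l * (p \<bullet> x)" using nonneg[OF assms(5)] by simp
      \<comment> \<open>At the eigenvector, \<open>balance\<close> reads
        \<open>c \<bullet> x + l * (p \<bullet> x) = 0\<close>, a sum of two nonnegative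
        terms.\<close>
      hence "c \<bullet> x = 0"
        using balance[of x] nonneg[OF c0] by (simp add: x(3))
      hence "(rowvector c :: real ^ 'n ^ 1) *v x = 0"
        by (simp add: vec_eq_iff rowvector_def matrix_vector_mult_def inner_vec_def)
      with detectable_eigenvector[OF assms(8) x(3) _ x(2)] \<open>\<not> l < 0\<close>
      show False by (simp add: c_def)
    qed
    with l show "Re \<mu> < 0" by linarith
  qed
qed

end
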